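(* Fix a cube $Q_0\subset\mathbb{R}^n$ and a local oscillation $\mathbb{B}_{Q_0}=\{B_Q\}_{Q\in\mathcal{D}(Q_0)}$ with constant $C_{\mathbb{B}}$. Let $f\in L^1(Q_0)$ be such that $$\frac1{|Q|}\int_Q|B_Qf(x)|\,dx\le a(Q)\qquad\text{for every }Q\in\mathcal{D}(Q_0),$$ where $a:\mathcal{D}(Q_0)\to[0,\infty)$ is a functional (possibly depending on $f$). Let $1<p<\infty$. If $a\in D_p^{\rm dyadic}(Q_0)$, then for every $Q\in\mathcal{D}(Q_0)$, $$\|B_Qf\|_{L^{p,\infty},Q}\le C\,\|a\|_{D_p^{\rm dyadic}(Q_0)}\,a(Q),$$ where $C$ depends only on $n$, $p$ and $C_{\mathbb{B}}$.
   Context: Cubes in $\mathbb{R}^n$ have sides parallel to the axes and are half-open. $\mathcal{D}(Q_0)$ is the family of dyadic subcubes of $Q_0$ (including $Q_0$), and $\mathcal D(Q)$ is defined likewise. $|E|$ is Lebesgue measure. A family $\mathbb{B}_{Q_0}=\{B_Q\}_{Q\in\mathcal{D}(Q_0)}$ is a local oscillation, with constant $C_{\mathbb{B}}$, if, setting $A_Q:=I-B_Q$: (a) for every $Q\in\mathcal{D}(Q_0)$, $A_Q$ is a linear operator acting on functions in $L^1(Q_0)$ (with values in measurable functions on $Q_0$); (b) for every $Q\in\mathcal{D}(Q_0)$ and $f\in L^1(Q_0)$, $\|A_Qf\|_{L^\infty(Q)}\le C_{\mathbb{B}}\frac1{|Q|}\int_Q|f|\,dy$; (c) for all $Q_1\subset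 Q_2$ in $\mathcal{D}(Q_0)$ and $f\in L^1(Q_0)$, $B_{Q_1}A_{Q_2}f=0$ a.e. in $Q_1$ (equivalently $A_{Q_1}A_{Q_2}f=A_{Q_2}f$ a.e. in $Q_1$). By (a) and (b), $A_Qf$ restricted to $Q$ depends only on $f|_Q$, so in (c) $A_{Q_2}f$ may be replaced by the bounded function $(A_{Q_2}f)\chi_{Q_2}$, and this is how the composition is understood. For a functional $a:\mathcal{D}(Q_0)\to[0,\infty)$ and $Q\in\mathcal{D}(Q_0)$, $\|a\|_{D_p,Q}=\frac{1}{a(Q)}\sup\big(\frac1{|Q|}\sum_ia(Q_i)^p|Q_i|\big)^{1/p}$, the supremum over all pairwise disjoint families $\{Q_i\}_i\subset\mathcal{D}(Q)$; that is, the least $c\in[0,\infty]$ such that $\sum_ia(Q_i)^p|Q_i|\le c^p\,a(Q)^p|Q|$ for all such families (this reading covers $a(Q)=0$: then $c=0$ if all the sums vanish and $c=\infty$ otherwise). One says $a\in D_p^{\rm dyadic}(Q_0)$ if $\|a\|_{D_p^{\rm dyadic}(Q_0)}:=\sup_{Q\in\mathcal{D}(Q_0)}\|a\|_{D_p,Q}<\infty$. $\|f\|_{L^{p,\infty},Q}=\sup_{\lambda>0}\lambda\big(|\{x\in Q:|f(x)|>\lambda\}|/|Q|\big)^{1/p}$. *)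

theory Defs
  imports "HOL-Analysis.Analysis"
begin

definition cube :: "real ^ 'n \<Rightarrow> real \<Rightarrow> (real ^ 'n) set" where
  "cube c l = {x. \<forall>i. c $ i \<le> x $ i \<and> x $ i < c $ i + l}"

definition is_cube :: "(real ^ 'n) set \<Rightarrow> bool" where
  "is_cube Q \<longleftrightarrow> (\<exists>c l. 0 < l \<and> Q = cube c l)"

text \<open>The corner and the side length of a half-open cube are determined by the cube as a set,
  so the dyadic subcubes can be defined from the set alone.\<close>

definition dyadic :: "(real ^ 'n) set \<Rightarrow> (real ^ 'n) set set" where
  "dyadic Q = {cube (\<chi> i. c $ i + l / 2 ^ k * real (m i)) (l / 2 ^ k) | c l k m.
     0 < l \<and> Q = cube c l \<and> (\<forall>i. m i < 2 ^ k)}"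

definition avg :: "(real ^ 'n) set \<Rightarrow> (real ^ 'n \<Rightarrow> real) \<Rightarrow> real" where
  "avg Q g = (\<integral>x. g x \<partial>(lebesgue_on Q)) / measure lebesgue Q"

text \<open>Functions on \<open>Q0\<close> are represented by total functions of which only the values on \<open>Q0\<close>,
  up to null sets, matter. Hence an operator on \<open>L\<^sup>1(Q0)\<close> has to respect equality a.e. in \<open>Q0\<close>,
  and its linearity is an identity a.e. in \<open>Q0\<close>. The type \<open>'b\<close> of scalars can be
  \<open>real\<close> or \<open>complex\<close>.\<close>

definition linear_op_L1 ::
  "(real ^ 'n) set \<Rightarrow>
   ((real ^ 'n \<Rightarrow> 'b::{real_normed_field, banach, second_countable_topology}) \<Rightarrow> real ^ 'n \<Rightarrow> 'b) \<Rightarrow>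
   bool" where
  "linear_op_L1 Q0 T \<longleftrightarrow>
    (\<forall>f. integrable (lebesgue_on Q0) f \<longrightarrow> T f \<in> borel_measurable (lebesgue_on Q0)) \<and>
    (\<forall>f g. integrable (lebesgue_on Q0) f \<longrightarrow> integrable (lebesgue_on Q0) g \<longrightarrow>
       (AE x in lebesgue_on Q0. f x = g x) \<longrightarrow> (AE x in lebesgue_on Q0. T f x = T g x)) \<and>
    (\<forall>f g. integrable (lebesgue_on Q0) f \<longrightarrow> integrable (lebesgue_on Q0) g \<longrightarrow>
       (AE x in lebesgue_on Q0. T (\<lambda>y. f y + g y) x = T f x + T g x)) \<and>
    (\<forall>c f. integrable (lebesgue_on Q0) f \<longrightarrow>
       (AE x in lebesgue_on Q0. T (\<lambda>y. c * f y) x = c * T f x))"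

definition compl_op ::
  "('c \<Rightarrow> ('d \<Rightarrow> 'b::ab_group_add) \<Rightarrow> 'd \<Rightarrow> 'b) \<Rightarrow> 'c \<Rightarrow> ('d \<Rightarrow> 'b) \<Rightarrow> 'd \<Rightarrow> 'b" where
  "compl_op B Q f = (\<lambda>x. f x - B Q f x)"

text \<open>In the last clause the composition is understood through the bounded function
  \<open>(A\<^bsub>Q2\<^esub> f) \<chi>\<^bsub>Q2\<^esub>\<close>, because \<open>A\<^bsub>Q2\<^esub> f\<close> need not be integrable on \<open>Q0\<close>.\<close>

definition local_oscillation ::
  "(real ^ 'n) set \<Rightarrow> real \<Rightarrow>
   ((real ^ 'n) set \<Rightarrow> (real ^ 'n \<Rightarrow> 'b::{real_normed_field, banach, second_countable_topology}) \<Rightarrow>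
     real ^ 'n \<Rightarrow> 'b) \<Rightarrow> bool" where
  "local_oscillation Q0 CB B \<longleftrightarrow>
    (\<forall>Q\<in>dyadic Q0. linear_op_L1 Q0 (compl_op B Q)) \<and>
    (\<forall>Q\<in>dyadic Q0. \<forall>f. integrable (lebesgue_on Q0) f \<longrightarrow>
       (AE x in lebesgue_on Q. norm (compl_op B Q f x) \<le> CB * avg Q (\<lambda>y. norm (f y)))) \<and>
    (\<forall>Q1\<in>dyadic Q0. \<forall>Q2\<in>dyadic Q0. Q1 \<subseteq> Q2 \<longrightarrow>
       (\<forall>f. integrable (lebesgue_on Q0) f \<longrightarrow>
         (AE x in lebesgue_on Q1. B Q1 (\<lambda>y. indicator Q2 y *\<^sub>R compl_op B Q2 f y) x = 0)))"

text \<open>The least \<open>c\<close> in \<open>[0,\<infinity>]\<close> such that the inequality holds for all disjoint families; the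
  infimum is \<open>\<infinity>\<close> if no finite \<open>c\<close> will do, which settles the case \<open>a Q = 0\<close>. The members of
  a pairwise disjoint family of cubes are distinct, so families are sets of cubes.\<close>

definition Dp_norm_at :: "real \<Rightarrow> ((real ^ 'n) set \<Rightarrow> real) \<Rightarrow> (real ^ 'n) set \<Rightarrow> ennreal" where
  "Dp_norm_at p a Q = (INF c\<in>{c::real. 0 \<le> c \<and>
     (\<forall>S\<subseteq>dyadic Q. disjoint S \<longrightarrow>
        (\<Sum>\<^sub>\<infinity>R\<in>S. ennreal (a R powr p * measure lebesgue R))
          \<le> ennreal (c powr p * a Q powr p * measure lebesgue Q))}. ennreal c)"

definition Dp_norm :: "real \<Rightarrow> (real ^ 'n) set \<Rightarrow> ((real ^ 'n) set \<Rightarrow> real) \<Rightarrow> ennreal" where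
  "Dp_norm p Q0 a = (SUP Q\<in>dyadic Q0. Dp_norm_at p a Q)"

definition weak_Lp_norm ::
  "real \<Rightarrow> (real ^ 'n) set \<Rightarrow> (real ^ 'n \<Rightarrow> 'b::real_normed_vector) \<Rightarrow> ennreal" where
  "weak_Lp_norm p Q f = (SUP t\<in>{0::real<..}.
     ennreal (t * (measure lebesgue {x\<in>Q. t < norm (f x)} / measure lebesgue Q) powr (1 / p)))"

end

(*
  Fix Q and put g = |B_Q f|.  For every dyadic R in Q the local oscillation axioms give
  g <= CB avg_R g + |B_R f| a.e. in R.  Let Omega_t be the union of the dyadic subcubes on which
  the average of g exceeds t.  On a maximal cube S of Omega_t, with t >= avg_Q g, the average of
  g is at most 2^n t, so with K = 2^n max(CB, 0) + 2 the cubes of Omega_(K t) inside S carry a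
  total integral of |B_S f| of at least t |Omega_(K t) \<inter> S|.  Summing over S gives the
  good-lambda inequality t |Omega_(K t)| <= sum_S a(S) |S|.  Splitting
  a(S) <= L + a(S)^p L^(1-p) with L a small multiple of t, the D_p condition turns it into a
  recursion for t^p |Omega_t| that bounds this quantity along t, K t, K^2 t, ...  Finally
  {g > t} is contained in Omega_t up to a null set.  It suffices to bound the total measure of
  finite disjoint families of cubes of Omega_t, so no infinite sums occur in the recursion.
*)
theory Submission
  imports Defs
begin

section \<open>Dyadic cubes\<close>

text \<open>Grid cube of generation \<open>k\<close> at integer position \<open>m\<close> below the
  root \<open>cube c l\<close>. Fixing the root once lets two dyadic cubes be compared through their
  addresses \<open>(k, m)\<close>.\<close>

definition dcube :: "real ^ 'n \<Rightarrow> real \<Rightarrow> nat \<Rightarrow> ('n \<Rightarrow> nat) \<Rightarrow> (real ^ 'n) set" where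
  "dcube c l k m = cube (\<chi> i. c $ i + l / 2 ^ k * real (m i)) (l / 2 ^ k)"

text \<open>Containment of one cube in another orders the near and the far faces in each coordinate,
  as the points on the main diagonal of the inner cube show; equality gives both orders. This makes
  the root hidden by the existential in \<open>dyadic\<close> unique.\<close>

lemma cube_eq_iff:
  assumes "0 < l" "0 < l'"
  shows "cube c l = cube c' l' \<longleftrightarrow> c = c' \<and> l = l'"
proof
  have sub: "c2 $ i \<le> c1 $ i \<and> c1 $ i + l1 \<le> c2 $ i + l2"
    if "0 < l1" "0 < l2" "cube c1 l1 \<subseteq> cube c2 l2" for c1 c2 :: "real ^ 'n" and l1 l2 i
  proof -
    have 1: "c1 + (\<chi> j. s) \<in> cube c2 l2" if "0 \<le> s" "s < l1" for s
      by (rule subsetD[OF \<open>cube c1 l1 \<subseteq> cube c2 l2\<close>]) (use that in \<open>auto simp: cube_def\<close>)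
    have 2: "c2 $ i \<le> c1 $ i + s \<and> c1 $ i + s < c2 $ i + l2" if "0 \<le> s" "s < l1" for s
      using 1[OF that] by (simp add: cube_def)
    \<comment> \<open>Otherwise the shift \<open>c2 $ i + l2 - c1 $ i\<close> is admissible and
      lands exactly on the far face, which a half-open cube omits.\<close>
    have "c1 $ i + l1 \<le> c2 $ i + l2"
    proof (rule ccontr)
      assume "\<not> c1 $ i + l1 \<le> c2 $ i + l2"
      then have "c2 $ i + l2 - c1 $ i < l1" by simp
      moreover have "0 \<le> c2 $ i + l2 - c1 $ i" using 2[of 0] \<open>0 < l1\<close> by simp
      ultimately show False using 2[of "c2 $ i + l2 - c1 $ i"] by simp
    qed
    then show ?thesis using 2[of 0] \<open>0 < l1\<close> by auto
  qed
  assume *: "cube c l = cube c' l'"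
  have "c' $ i = c $ i \<and> l = l'" for i
    using sub[of l l' c c' i] sub[of l' l c' c i] * assms by simp
  then show "c = c' \<and> l = l'" by (simp add: vec_eq_iff)
qed auto

lemma dyadic_cube:
  assumes "0 < l"
  shows "dyadic (cube c l) = {dcube c l k m | k m. \<forall>i. m i < 2 ^ k}"
proof
  show "dyadic (cube c l) \<subseteq> {dcube c l k m | k m. \<forall>i. m i < 2 ^ k}"
  proof
    fix R assume "R \<in> dyadic (cube c l)"
    then obtain c' l' k m where *: "R = dcube c' l' k m" "0 < l'" "cube c l = cube c' l'" "\<forall>i. m i < 2 ^ k"
      unfolding dyadic_def dcube_def by blast
    then have "c' = c" "l' = l" using assms cube_eq_iff by metis+
    then show "R \<in> {dcube c l k m | k m. \<forall>i. m i < 2 ^ k}" using * by blast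
  qed
  show "{dcube c l k m | k m. \<forall>i. m i < 2 ^ k} \<subseteq> dyadic (cube c l)"
    unfolding dyadic_def dcube_def using assms by blast
qed

lemma dyadicE:
  assumes "R \<in> dyadic Q"
  obtains c l k m where "0 < l" "Q = cube c l" "R = dcube c l k m" "\<And>i. m i < 2 ^ k"
proof -
  have "\<exists>c l k m. 0 < l \<and> Q = cube c l \<and> R = dcube c l k m \<and> (\<forall>i. m i < 2 ^ k)"
    using assms unfolding dyadic_def dcube_def by blast
  then show ?thesis using that by blast
qed

lemma dcubeI:
  assumes "0 < l" "\<And>i. m i < 2 ^ k"
  shows "dcube c l k m \<in> dyadic (cube c l)"
  using assms by (auto simp: dyadic_cube)

text \<open>Half-open sides make each coordinate condition a floor identity, so questions of nesting
  become integer arithmetic on positions.\<close>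

lemma mem_dcube:
  assumes "0 < l"
  shows "x \<in> dcube c l k m \<longleftrightarrow> (\<forall>i. \<lfloor>(x $ i - c $ i) / l * 2 ^ k\<rfloor> = int (m i))"
  using assms by (simp add: dcube_def cube_def floor_eq_iff field_simps)

lemma dcube_0:
  assumes "\<And>i. m i < 2 ^ 0"
  shows "dcube c l 0 m = cube c l"
  using assms by (simp add: dcube_def)

lemma dyadic_is_cube:
  assumes "R \<in> dyadic Q"
  shows "is_cube R" "is_cube Q"
proof -
  obtain c l k m where "0 < l" "Q = cube c l" "R = dcube c l k m"
    using assms by (rule dyadicE)
  moreover from this have "0 < l / 2 ^ k" by simp
  ultimately show "is_cube R" "is_cube Q"
    unfolding is_cube_def dcube_def by blast+
qed

lemma dyadic_refl: "is_cube Q \<Longrightarrow> Q \<in> dyadic Q"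
proof -
  assume "is_cube Q"
  then obtain c l where "0 < l" "Q = cube c l" by (auto simp: is_cube_def)
  then show ?thesis using dcubeI[of l "\<lambda>_. 0" 0 c] by (simp add: dcube_0)
qed

text \<open>The scaled floor at generation \<open>k\<close> is the one at generation
  \<open>k'\<close> divided by a power of 2 in the integers. Thus the finer address determines the
  coarser one, and a single common point decides containment.\<close>

lemma dcube_ancestor:
  assumes "0 < l" "k \<le> k'" "x \<in> dcube c l k m" "x \<in> dcube c l k' m'"
  shows "dcube c l k' m' \<subseteq> dcube c l k m"
proof
  fix z assume z: "z \<in> dcube c l k' m'"
  have fl: "\<lfloor>y * 2 ^ k\<rfloor> = \<lfloor>y * 2 ^ k'\<rfloor> div 2 ^ (k' - k)" for y :: real
  proof -
    have "\<lfloor>y * 2 ^ k\<rfloor> = \<lfloor>y * 2 ^ k' / real_of_int (2 ^ (k' - k))\<rfloor>"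
      using assms(2) by (auto simp: le_iff_add power_add)
    then show ?thesis using floor_divide_real_eq_div[of "2 ^ (k' - k)" "y * 2 ^ k'"] by simp
  qed
  show "z \<in> dcube c l k m"
    using z assms by (simp add: mem_dcube fl del: times_divide_eq_left)
qed

lemma dyadic_nested:
  assumes "R \<in> dyadic Q" "S \<in> dyadic Q" "R \<inter> S \<noteq> {}"
  shows "R \<subseteq> S \<or> S \<subseteq> R"
proof -
  obtain c l k m where R: "0 < l" "Q = cube c l" "R = dcube c l k m"
    using assms(1) by (rule dyadicE)
  obtain k' m' where S: "S = dcube c l k' m'"
    using assms(2) R by (auto simp: dyadic_cube)
  obtain x where "x \<in> R" "x \<in> S" using assms(3) by auto
  then show ?thesis
    using dcube_ancestor[of l k k' x c m m'] dcube_ancestor[of l k' k x c m' m] R S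
    by (cases "k \<le> k'") auto
qed

lemma dyadic_trans:
  assumes "R \<in> dyadic Q" "Q \<in> dyadic P"
  shows "R \<in> dyadic P"
proof -
  obtain c l k m where Q: "0 < l" "P = cube c l" "Q = dcube c l k m" "\<And>i. m i < 2 ^ k"
    using assms(2) by (metis dyadicE)
  obtain j r where R: "R = dcube (\<chi> i. c $ i + l / 2 ^ k * real (m i)) (l / 2 ^ k) j r"
      "\<And>i. r i < 2 ^ j"
    using assms(1) Q by (auto simp: dcube_def[of c l k m] dyadic_cube)
  \<comment> \<open>Subdividing \<open>j\<close> more times appends the binary digits of
    \<open>r i\<close> to those of \<open>m i\<close>.\<close>
  have "R = dcube c l (k + j) (\<lambda>i. m i * 2 ^ j + r i)"
    unfolding R dcube_def by (intro arg_cong2[where f = cube]) (auto simp: vec_eq_iff field_simps power_add)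
  moreover have "m i * 2 ^ j + r i < 2 ^ (k + j)" for i
  proof -
    have "m i * 2 ^ j + r i < (m i + 1) * 2 ^ j" using R(2)[of i] by simp
    also have "\<dots> \<le> 2 ^ k * 2 ^ j" using Q(4)[of i] by (intro mult_right_mono) auto
    finally show ?thesis by (simp add: power_add)
  qed
  ultimately show ?thesis using Q(1,2) by (simp add: dcubeI)
qed

lemma dyadic_subset:
  assumes "R \<in> dyadic Q"
  shows "R \<subseteq> Q"
proof -
  obtain c l k m where R: "0 < l" "Q = cube c l" "R = dcube c l k m" "\<And>i. m i < 2 ^ k"
    using assms by (metis dyadicE)
  have "x \<in> cube c l" if "x \<in> R" for x
  proof -
    have x: "c $ i + l / 2 ^ k * real (m i) \<le> x $ i" "x $ i < c $ i + l / 2 ^ k * (real (m i) + 1)" for i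
      using that by (auto simp: R(3) dcube_def cube_def algebra_simps add_divide_distrib)
    have "l / 2 ^ k * (real (m i) + 1) \<le> l" for i
    proof -
      have "real (m i) + 1 \<le> 2 ^ k" using R(4)[of i]
        by (metis Suc_eq_plus1 Suc_leI of_nat_1 of_nat_add of_nat_le_iff of_nat_numeral of_nat_power)
      then have "l * (real (m i) + 1) \<le> l * 2 ^ k" using R(1) by (intro mult_left_mono) auto
      then show ?thesis by (simp add: field_simps)
    qed
    moreover have "0 \<le> l / 2 ^ k * real (m i)" for i using R(1) by simp
    ultimately show ?thesis using x unfolding cube_def by (smt (verit) mem_Collect_eq)
  qed
  then show ?thesis using R by auto
qed

section \<open>Lebesgue measure of cubes, parents and small cubes\<close>

lemma cube_measure:
  fixes c :: "real ^ 'n"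
  assumes "0 < l"
  shows "cube c l \<in> lmeasurable" "measure lebesgue (cube c l) = l ^ CARD('n)"
proof -
  let ?b = "c + (\<chi> i. l)"
  have sub: "box c ?b \<subseteq> cube c l" "cube c l \<subseteq> cbox c ?b"
    by (auto simp: cube_def mem_box_cart less_imp_le)
  have neg: "negligible (cbox c ?b - box c ?b)"
    by (rule negligible_frontier_interval)
  \<comment> \<open>The half-open cube lies between the open and the closed box, so it differs from
    the closed one only on the boundary.\<close>
  have sd: "negligible ((cbox c ?b - cube c l) \<union> (cube c l - cbox c ?b))"
    by (rule negligible_subset[OF neg]) (use sub in auto)
  show "cube c l \<in> lmeasurable"
    using lmeasurable_negligible_symdiff[OF _ sd] by auto
  have "measure lebesgue (cube c l) = measure lebesgue (cbox c ?b)"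
    using measure_negligible_symdiff[OF _ sd] by auto
  also have "\<dots> = l ^ CARD('n)"
    using assms by (simp add: content_cbox_cart interval_ne_empty_cart less_imp_le)
  finally show "measure lebesgue (cube c l) = l ^ CARD('n)" .
qed

lemma is_cube_lmeasurable: "is_cube Q \<Longrightarrow> Q \<in> lmeasurable"
  by (auto simp: is_cube_def cube_measure)

lemma is_cube_measure_pos: "is_cube Q \<Longrightarrow> 0 < measure lebesgue Q"
  by (auto simp: is_cube_def cube_measure)

lemma is_cube_nonempty: "is_cube Q \<Longrightarrow> Q \<noteq> {}"
  using is_cube_measure_pos by fastforce

text \<open>Dropping the last binary digit of each coordinate of the position gives the parent. The
  exact measure ratio is the source of the factor \<open>2 ^ CARD('n)\<close> in the final
  constant.\<close>

lemma dyadic_parent: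
  fixes Q :: "(real ^ 'n) set"
  assumes "R \<in> dyadic Q" "R \<noteq> Q"
  obtains P where "P \<in> dyadic Q" "R \<subset> P" "measure lebesgue P = 2 ^ CARD('n) * measure lebesgue R"
proof -
  obtain c l k m where R: "0 < l" "Q = cube c l" "R = dcube c l k m" "\<And>i. m i < 2 ^ k"
    using assms(1) by (metis dyadicE)
  have "k \<noteq> 0" using R assms(2) dcube_0 by metis
  then obtain j where k: "k = Suc j" by (cases k) auto
  let ?P = "dcube c l j (\<lambda>i. m i div 2)"
  have PQ: "?P \<in> dyadic Q" unfolding R(2) using R(4) R(1) k by (intro dcubeI) (auto simp: less_mult_imp_div_less mult.commute)
  have meas: "measure lebesgue ?P = 2 ^ CARD('n) * measure lebesgue R"
    unfolding R(3) dcube_def using R(1) k by (simp add: cube_measure field_simps power_mult_distrib)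
  have pos: "0 < measure lebesgue R" "0 < measure lebesgue ?P"
    using assms(1) PQ dyadic_is_cube is_cube_measure_pos by blast+
  have "R \<subseteq> ?P"
  proof -
    obtain x where x: "x \<in> R" using pos(1) by fastforce
    have "\<lfloor>y * 2 ^ j\<rfloor> = \<lfloor>y * 2 ^ k\<rfloor> div 2" for y :: real
      using floor_divide_real_eq_div[of 2 "y * 2 ^ k"] by (simp add: k)
    then have "x \<in> ?P" using x R(1) by (simp add: R(3) mem_dcube zdiv_int del: times_divide_eq_left)
    then show ?thesis using dcube_ancestor[of l j k x c _ m] x R(1,3) k by auto
  qed
  moreover have "R \<noteq> ?P"
  proof
    assume "R = ?P"
    then have "(2::real) ^ CARD('n) = 1" using meas pos by simp
    moreover have "(1::real) < 2 ^ CARD('n)" by (rule one_less_power) auto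
    ultimately show False by linarith
  qed
  ultimately show ?thesis using that[OF PQ _ meas] by blast
qed

lemma dyadic_small:
  fixes Q :: "(real ^ 'n) set"
  assumes "is_cube Q" "x \<in> Q" "open U" "x \<in> U"
  obtains R where "R \<in> dyadic Q" "x \<in> R" "R \<subseteq> U"
proof -
  obtain c l where Q: "0 < l" "Q = cube c l" using assms(1) by (auto simp: is_cube_def)
  obtain e where e: "0 < e" "ball x e \<subseteq> U" using assms(3,4) openE by blast
  \<comment> \<open>The factor \<open>CARD('n)\<close> appears because the Euclidean norm is
    estimated by the sum of the coordinates, each at most one side length.\<close>
  obtain k where k: "real CARD('n) * l / e < 2 ^ k" using real_arch_pow[of 2] by auto
  then have k': "real CARD('n) * (l / 2 ^ k) < e" using e(1) by (simp add: field_simps)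
  define m where "m i = nat \<lfloor>(x $ i - c $ i) / l * 2 ^ k\<rfloor>" for i
  have nn: "0 \<le> (x $ i - c $ i) / l * 2 ^ k" "(x $ i - c $ i) / l * 2 ^ k < 2 ^ k" for i
    using assms(2) Q by (auto simp: cube_def pos_divide_less_eq diff_less_eq add.commute)
  have x: "x \<in> dcube c l k m" unfolding mem_dcube[OF Q(1)] m_def using nn by simp
  have "m i < 2 ^ k" for i
    unfolding m_def using nn(2)[of i] by (simp add: nat_less_iff floor_less_iff)
  then have D: "dcube c l k m \<in> dyadic Q" unfolding Q(2) using Q(1) by (intro dcubeI)
  have "y \<in> ball x e" if "y \<in> dcube c l k m" for y
  proof -
    have "\<bar>(x - y) $ i\<bar> \<le> l / 2 ^ k" for i
    proof -
      have "c $ i + l / 2 ^ k * real (m i) \<le> z $ i" "z $ i < c $ i + l / 2 ^ k * real (m i) + l / 2 ^ k"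
        if "z \<in> dcube c l k m" for z
        using that by (auto simp: dcube_def cube_def)
      from this[OF x] this[OF that] show ?thesis by (simp add: abs_le_iff)
    qed
    then have "(\<Sum>i\<in>UNIV. \<bar>(x - y) $ i\<bar>) \<le> real CARD('n) * (l / 2 ^ k)"
      using sum_bounded_above[of UNIV "\<lambda>i. \<bar>(x - y) $ i\<bar>" "l / 2 ^ k"] by simp
    then show ?thesis using norm_le_l1_cart[of "x - y"] k' by (simp add: dist_norm)
  qed
  then show ?thesis using that D x e(2) by blast
qed

lemma countable_dyadic: "countable (dyadic Q)"
proof (cases "is_cube Q")
  case True
  then obtain c l where Q: "0 < l" "Q = cube c l" by (auto simp: is_cube_def)
  have "dyadic Q \<subseteq> (\<lambda>(k, v). dcube c l k (\<lambda>i. v $ i)) ` (UNIV :: (nat \<times> (nat ^ 'a)) set)"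
  proof
    fix R assume "R \<in> dyadic Q"
    then obtain k m where "R = dcube c l k m" using Q by (auto simp: dyadic_cube)
    then show "R \<in> (\<lambda>(k, v). dcube c l k (\<lambda>i. v $ i)) ` UNIV"
      by (intro image_eqI[where x = "(k, \<chi> i. m i)"]) (auto simp: vec_lambda_inverse)
  qed
  then show ?thesis by (rule countable_subset) simp
next
  case False
  then have "dyadic Q = {}" using dyadic_is_cube by blast
  then show ?thesis by simp
qed

text \<open>An ancestor contains a chosen point of \<open>R\<close>, so its generation alone
  determines its position; comparing measures shows that this generation is at most that of
  \<open>R\<close>.\<close>

lemma finite_dyadic_ancestors:
  fixes Q :: "(real ^ 'n) set"
  assumes "R \<in> dyadic Q"
  shows "finite {S \<in> dyadic Q. R \<subseteq> S}"
proof -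
  obtain c l k m where R: "0 < l" "Q = cube c l" "R = dcube c l k m"
    using assms by (metis dyadicE)
  obtain x where x: "x \<in> R" using assms dyadic_is_cube is_cube_nonempty by blast
  have "{S \<in> dyadic Q. R \<subseteq> S} \<subseteq> (\<lambda>j. dcube c l j (\<lambda>i. nat \<lfloor>(x $ i - c $ i) / l * 2 ^ j\<rfloor>)) ` {..k}"
  proof clarify
    fix S assume S: "S \<in> dyadic Q" "R \<subseteq> S"
    obtain j r where j: "S = dcube c l j r" using S(1) R by (auto simp: dyadic_cube)
    have "r i = nat \<lfloor>(x $ i - c $ i) / l * 2 ^ j\<rfloor>" for i
      using x S(2) R(1) j by (auto simp: mem_dcube subset_iff)
    then have S': "S = dcube c l j (\<lambda>i. nat \<lfloor>(x $ i - c $ i) / l * 2 ^ j\<rfloor>)" using j by presburger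
    have "measure lebesgue R \<le> measure lebesgue S"
      using S assms dyadic_is_cube is_cube_lmeasurable
      by (intro measure_mono_fmeasurable) (blast intro: fmeasurableD)+
    then have "l / 2 ^ k \<le> l / 2 ^ j"
      using R(1) unfolding R(3) j dcube_def
      by (simp add: cube_measure power_mono_iff del: power_divide)
    then have "j \<le> k" using R(1) by (simp add: field_simps)
    then show "S \<in> (\<lambda>j. dcube c l j (\<lambda>i. nat \<lfloor>(x $ i - c $ i) / l * 2 ^ j\<rfloor>)) ` {..k}"
      using S' by blast
  qed
  then show ?thesis by (rule finite_subset) simp
qed

section \<open>Maximal cubes of a dyadic family\<close>

definition maximal_cubes :: "'a set set \<Rightarrow> 'a set set" where
  "maximal_cubes T = {M \<in> T. \<forall>S\<in>T. M \<subseteq> S \<longrightarrow> S = M}"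

lemma maximal_cubes_cover:
  assumes "T \<subseteq> dyadic Q" "R \<in> T"
  obtains M where "M \<in> maximal_cubes T" "R \<subseteq> M"
proof -
  have "finite {S \<in> T. R \<subseteq> S}"
    by (rule finite_subset[OF _ finite_dyadic_ancestors[of R Q]]) (use assms in auto)
  from finite_has_maximal2[OF this, of R] assms obtain M
    where M: "M \<in> T" "R \<subseteq> M" "\<forall>S\<in>{S \<in> T. R \<subseteq> S}. M \<subseteq> S \<longrightarrow> M = S" by auto
  then have "M \<in> maximal_cubes T" unfolding maximal_cubes_def by auto
  then show ?thesis using that M(2) by blast
qed

lemma Union_maximal_cubes:
  assumes "T \<subseteq> dyadic Q"
  shows "\<Union>(maximal_cubes T) = \<Union>T"
proof
  show "\<Union>(maximal_cubes T) \<subseteq> \<Union>T" by (auto simp: maximal_cubes_def)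
  show "\<Union>T \<subseteq> \<Union>(maximal_cubes T)" by (meson Union_least Union_upper assms maximal_cubes_cover order_trans)
qed

lemma disjoint_maximal_cubes:
  assumes "T \<subseteq> dyadic Q"
  shows "disjoint (maximal_cubes T)"
proof (rule disjointI)
  fix R S assume "R \<in> maximal_cubes T" "S \<in> maximal_cubes T" "R \<noteq> S"
  then show "R \<inter> S = {}"
    using dyadic_nested[of R Q S] assms unfolding maximal_cubes_def by blast
qed

section \<open>Dyadic averages and level sets\<close>

lemma dyadic_sets: "R \<in> dyadic Q \<Longrightarrow> R \<in> sets lebesgue"
  by (meson dyadic_is_cube(1) fmeasurableD is_cube_lmeasurable)

lemma dyadic_measure_pos: "R \<in> dyadic Q \<Longrightarrow> 0 < measure lebesgue R"
  by (meson dyadic_is_cube(1) is_cube_measure_pos)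

lemma sum_measure_dyadic_le:
  assumes "finite F" "disjoint F" "F \<subseteq> dyadic Q" "is_cube Q"
  shows "(\<Sum>R\<in>F. measure lebesgue R) \<le> measure lebesgue Q"
proof -
  have F: "R \<in> lmeasurable" if "R \<in> F" for R
    using that assms(3) dyadic_is_cube(1) is_cube_lmeasurable by blast
  have "(\<Sum>R\<in>F. measure lebesgue R) = measure lebesgue (\<Union>F)"
    using assms(1,2) F by (intro measure_Union'[symmetric]) auto
  also have "\<dots> \<le> measure lebesgue Q"
  proof (rule measure_mono_fmeasurable)
    show "\<Union>F \<subseteq> Q" using assms(3) dyadic_subset by blast
    show "\<Union>F \<in> sets lebesgue" using assms(1) F by (intro sets.finite_Union) auto
  qed (rule is_cube_lmeasurable[OF assms(4)])
  finally show ?thesis .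
qed

section \<open>Integrals over cubes and disjoint families\<close>

lemma integral_lebesgue_on_eq_avg:
  assumes "is_cube R"
  shows "(\<integral>x. g x \<partial>lebesgue_on R) = avg R g * measure lebesgue R"
  using is_cube_measure_pos[OF assms] by (simp add: avg_def)

lemma set_integrable_lebesgue_on:
  fixes f :: "real ^ 'n \<Rightarrow> 'b::{banach, second_countable_topology}"
  assumes "S \<in> sets lebesgue"
  shows "integrable (lebesgue_on S) f \<longleftrightarrow> set_integrable lebesgue S f"
    "(\<integral>x. f x \<partial>lebesgue_on S) = (LINT x:S|lebesgue. f x)"
  using assms by (simp_all add: integrable_restrict_space integral_restrict_space
      set_integrable_def set_lebesgue_integral_def)

lemma integrable_lebesgue_on_subset:
  fixes f :: "real ^ 'n \<Rightarrow> 'b::{banach, second_countable_topology}"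
  assumes "integrable (lebesgue_on S) f" "S \<in> sets lebesgue" "R \<in> sets lebesgue" "R \<subseteq> S"
  shows "integrable (lebesgue_on R) f"
  using assms set_integrable_subset[of lebesgue S f R] by (simp add: set_integrable_lebesgue_on)

lemma const_lebesgue_on:
  fixes c :: real
  assumes "R \<in> lmeasurable"
  shows "integrable (lebesgue_on R) (\<lambda>x. c)" "(\<integral>x. c \<partial>lebesgue_on R) = c * measure lebesgue R"
  using assms finite_measure.integrable_const[OF finite_measure_lebesgue_on[OF assms]]
  by (auto simp: measure_restrict_space space_restrict_space fmeasurableD)

lemma sum_integral_disjoint_le:
  fixes g :: "real ^ 'n \<Rightarrow> real"
  assumes "finite F" "disjoint F" "\<And>R. R \<in> F \<Longrightarrow> R \<in> sets lebesgue" "\<Union>F \<subseteq> S" "S \<in> sets lebesgue"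
    and "integrable (lebesgue_on S) g" "\<And>x. 0 \<le> g x"
  shows "(\<Sum>R\<in>F. \<integral>x. g x \<partial>lebesgue_on R) \<le> (\<integral>x. g x \<partial>lebesgue_on S)"
proof -
  have S: "set_integrable lebesgue S g" using assms by (simp add: set_integrable_lebesgue_on)
  have U: "\<Union>F \<in> sets lebesgue" using assms by (intro sets.finite_Union) auto
  have "(\<Sum>R\<in>F. \<integral>x. g x \<partial>lebesgue_on R) = (\<Sum>R\<in>F. LINT x:R|lebesgue. g x)"
    using assms(3) by (simp add: set_integrable_lebesgue_on)
  also have "\<dots> = (LINT x:(\<Union>R\<in>F. R)|lebesgue. g x)"
    using assms(1-4)
    by (intro set_integral_finite_Union[symmetric] set_integrable_subset[OF S])
      (auto simp: disjoint_family_on_def disjoint_def)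
  also have "\<dots> \<le> (LINT x:S|lebesgue. g x)"
    using set_integrable_subset[OF S U assms(4)] S assms(4,7)
    unfolding set_lebesgue_integral_def set_integrable_def
    by (intro integral_mono) (auto split: split_indicator)
  finally show ?thesis using assms(5) by (simp add: set_integrable_lebesgue_on)
qed

lemma integral_subset_le:
  fixes g :: "real ^ 'n \<Rightarrow> real"
  assumes "R \<in> sets lebesgue" "R \<subseteq> S" "S \<in> sets lebesgue"
    and "integrable (lebesgue_on S) g" "\<And>x. 0 \<le> g x"
  shows "(\<integral>x. g x \<partial>lebesgue_on R) \<le> (\<integral>x. g x \<partial>lebesgue_on S)"
  using sum_integral_disjoint_le[of "{R}" S g] assms by simp

text \<open>This takes the place of Lebesgue's differentiation theorem: an open set of nearly the same
  measure containing the superlevel set is exhausted by maximal dyadic cubes, on each of which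
  the average is at most \<open>t\<close>.\<close>

lemma avg_le_imp_superlevel_null:
  fixes g :: "real ^ 'n \<Rightarrow> real"
  assumes Q: "is_cube Q" and g: "integrable (lebesgue_on Q) g" "\<And>x. 0 \<le> g x"
    and N: "N \<subseteq> Q" "N \<in> sets lebesgue" and t: "0 \<le> t"
    and avg: "\<And>R. R \<in> dyadic Q \<Longrightarrow> R \<inter> N \<noteq> {} \<Longrightarrow> avg R g \<le> t"
  shows "{x \<in> N. t < g x} \<in> null_sets lebesgue"
proof -
  let ?E = "{x \<in> N. t < g x}"
  have Qs: "Q \<in> sets lebesgue" using Q by (simp add: fmeasurableD is_cube_lmeasurable)
  have gm: "(\<lambda>x. indicator Q x *\<^sub>R g x) \<in> borel_measurable lebesgue"
    using g(1) Qs by (auto simp: integrable_restrict_space)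
  define w where "w x = ennreal (indicator Q x *\<^sub>R g x)" for x
  have w: "w \<in> borel_measurable lebesgue" unfolding w_def using gm by measurable
  \<comment> \<open>With \<open>g\<close>, extended by zero outside \<open>Q\<close>, as density,
    the claim reduces to showing that the \<nu>-measure of the superlevel set is at most
    \<open>t\<close> times its Lebesgue measure.\<close>
  define \<nu> where "\<nu> = density lebesgue w"
  have [simp]: "sets \<nu> = sets lebesgue" by (simp add: \<nu>_def)
  have \<nu>: "emeasure \<nu> A = (\<integral>\<^sup>+x. w x * indicator A x \<partial>lebesgue)" if "A \<in> sets lebesgue" for A
    unfolding \<nu>_def using w that by (rule emeasure_density)
  have \<nu>R: "emeasure \<nu> R \<le> ennreal t * emeasure lebesgue R" if R: "R \<in> dyadic Q" "R \<inter> N \<noteq> {}" for R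
  proof -
    have Rs: "R \<in> sets lebesgue" "R \<subseteq> Q" using R(1) by (rule dyadic_sets, rule dyadic_subset)
    have gR: "integrable (lebesgue_on R) g" using integrable_lebesgue_on_subset[OF g(1) Qs Rs] .
    have "emeasure \<nu> R = (\<integral>\<^sup>+x. ennreal (g x) * indicator R x \<partial>lebesgue)"
      unfolding \<nu>[OF Rs(1)] w_def using Rs(2) by (intro nn_integral_cong) (auto split: split_indicator)
    also have "\<dots> = (\<integral>\<^sup>+x. ennreal (g x) \<partial>lebesgue_on R)"
      using Rs(1) by (simp add: nn_integral_restrict_space)
    also have "\<dots> = ennreal (avg R g * measure lebesgue R)"
      using nn_integral_eq_integral[OF gR] g(2) dyadic_is_cube(1)[OF R(1)]
      by (simp add: integral_lebesgue_on_eq_avg)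
    also have "\<dots> \<le> ennreal (t * measure lebesgue R)"
      by (intro ennreal_leI mult_right_mono avg R) auto
    also have "\<dots> = ennreal t * emeasure lebesgue R"
      using is_cube_lmeasurable[OF dyadic_is_cube(1)[OF R(1)]] t
      by (simp add: ennreal_mult emeasure_eq_measure2)
    finally show ?thesis .
  qed
  have Es: "?E \<in> sets lebesgue"
  proof -
    have "?E = N \<inter> {x \<in> space lebesgue. t < indicator Q x *\<^sub>R g x}"
      using N(1) t by (auto split: split_indicator)
    moreover have "{x \<in> space lebesgue. t < indicator Q x *\<^sub>R g x} \<in> sets lebesgue"
      using gm by measurable
    ultimately show ?thesis using N(2) by simp
  qed
  have Em: "?E \<in> lmeasurable"
    using Es N(1) by (intro fmeasurableI2[OF is_cube_lmeasurable[OF Q]]) auto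
  have \<nu>E: "emeasure \<nu> ?E \<le> ennreal t * emeasure lebesgue ?E + ennreal e" if e: "0 < e" for e
  proof -
    \<comment> \<open>Dividing by \<open>t + 1\<close> also covers \<open>t = 0\<close> and still
      yields \<open>t * d \<le> e\<close>.\<close>
    define d where "d = e / (t + 1)"
    have d: "0 < d" "t * d \<le> e" using e t by (auto simp: d_def field_simps)
    obtain U where U: "open U" "?E \<subseteq> U" "U - ?E \<in> lmeasurable" "emeasure lebesgue (U - ?E) < ennreal d"
      using sets_lebesgue_outer_open[OF Es d(1)] by blast
    \<comment> \<open>Only cubes meeting \<open>N\<close> have controlled averages. Nothing of the
      superlevel set is lost, since a small cube around one of its points meets \<open>N\<close> at
      that point.\<close>
    define T where "T = {R \<in> dyadic Q. R \<subseteq> U \<and> R \<inter> N \<noteq> {}}"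
    define V where "V = \<Union>(maximal_cubes T)"
    have TQ: "T \<subseteq> dyadic Q" by (auto simp: T_def)
    have mT: "maximal_cubes T \<subseteq> T" by (auto simp: maximal_cubes_def)
    have V: "V = \<Union>T" unfolding V_def by (rule Union_maximal_cubes[OF TQ])
    have EV: "?E \<subseteq> V"
    proof
      fix x assume x: "x \<in> ?E"
      obtain R where "R \<in> dyadic Q" "x \<in> R" "R \<subseteq> U"
        using dyadic_small[OF Q, of x U] x N(1) U(1,2) by blast
      then show "x \<in> V" using x unfolding V T_def by blast
    qed
    have VU: "V \<subseteq> U" unfolding V T_def by blast
    have cnt: "countable (maximal_cubes T)"
      using countable_dyadic mT TQ by (meson countable_subset)
    have ms: "R \<in> sets lebesgue" if "R \<in> maximal_cubes T" for R
      using that mT TQ dyadic_sets by blast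
    have disj: "disjoint_family_on (\<lambda>R. R) (maximal_cubes T)"
      using disjoint_maximal_cubes[OF TQ] by (auto simp: disjoint_family_on_def disjoint_def)
    have Vs: "V \<in> sets lebesgue" unfolding V_def using cnt ms by (intro sets.countable_Union) auto
    \<comment> \<open>The measure \<open>L\<close> is left open because the decomposition into
      maximal cubes serves both \<nu> and \<open>lebesgue\<close>.\<close>
    have em: "emeasure L V = (\<integral>\<^sup>+R. emeasure L R \<partial>count_space (maximal_cubes T))"
      if "sets L = sets lebesgue" for L
      using emeasure_UN_countable[of "maximal_cubes T" "\<lambda>R. R" L] cnt ms disj that
      by (simp add: V_def)
    have "emeasure \<nu> ?E \<le> emeasure \<nu> V" using EV Vs by (intro emeasure_mono) auto
    also have "\<dots> = (\<integral>\<^sup>+R. emeasure \<nu> R \<partial>count_space (maximal_cubes T))" by (rule em) simp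
    also have "\<dots> \<le> (\<integral>\<^sup>+R. ennreal t * emeasure lebesgue R \<partial>count_space (maximal_cubes T))"
      using mT by (intro nn_integral_mono \<nu>R) (auto simp: T_def)
    also have "\<dots> = ennreal t * emeasure lebesgue V"
      by (simp add: nn_integral_cmult em)
    also have "emeasure lebesgue V \<le> emeasure lebesgue (?E \<union> (U - ?E))"
      using VU U Es by (intro emeasure_mono) auto
    also have "\<dots> \<le> emeasure lebesgue ?E + emeasure lebesgue (U - ?E)"
      using Es U(3) by (intro emeasure_subadditive) auto
    also have "ennreal t * \<dots> \<le> ennreal t * (emeasure lebesgue ?E + ennreal d)"
      using U(4) by (intro mult_left_mono add_left_mono) auto
    also have "\<dots> = ennreal t * emeasure lebesgue ?E + ennreal (t * d)"
      using t d by (simp add: distrib_left ennreal_mult)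
    also have "\<dots> \<le> ennreal t * emeasure lebesgue ?E + ennreal e"
      using d by (intro add_left_mono ennreal_leI)
    finally show ?thesis by (simp add: mult_left_mono)
  qed
  have "emeasure \<nu> ?E \<le> ennreal t * emeasure lebesgue ?E"
    by (rule ennreal_le_epsilon) (use \<nu>E in auto)
  \<comment> \<open>The excess \<open>g - t\<close> is split off so that the common term can be
    cancelled; the cancellation relies on its finiteness. The excess then has integral zero although
    it is positive on the set.\<close>
  moreover have "emeasure \<nu> ?E = (\<integral>\<^sup>+x. ennreal (g x - t) * indicator ?E x \<partial>lebesgue) + ennreal t * emeasure lebesgue ?E"
  proof -
    have "emeasure \<nu> ?E = (\<integral>\<^sup>+x. ennreal (indicator Q x *\<^sub>R g x - t) * indicator ?E x + ennreal t * indicator ?E x \<partial>lebesgue)"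
      unfolding \<nu>[OF Es] w_def using t N(1)
      by (intro nn_integral_cong) (auto split: split_indicator simp flip: ennreal_plus)
    also have "\<dots> = (\<integral>\<^sup>+x. ennreal (indicator Q x *\<^sub>R g x - t) * indicator ?E x \<partial>lebesgue) + ennreal t * emeasure lebesgue ?E"
      using Es gm by (subst nn_integral_add) (auto simp: nn_integral_cmult_indicator)
    also have "(\<integral>\<^sup>+x. ennreal (indicator Q x *\<^sub>R g x - t) * indicator ?E x \<partial>lebesgue)
        = (\<integral>\<^sup>+x. ennreal (g x - t) * indicator ?E x \<partial>lebesgue)"
      using N(1) by (intro nn_integral_cong) (auto split: split_indicator)
    finally show ?thesis .
  qed
  moreover have "ennreal t * emeasure lebesgue ?E \<noteq> \<infinity>"
    using Em by (simp add: emeasure_eq_measure2 ennreal_mult_eq_top_iff)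
  ultimately have "(\<integral>\<^sup>+x. ennreal (g x - t) * indicator ?E x \<partial>lebesgue) = 0"
    using ennreal_add_left_cancel_le[of "ennreal t * emeasure lebesgue ?E" _ 0] by (simp add: add.commute)
  moreover have "(\<lambda>x. ennreal (g x - t) * indicator ?E x) \<in> borel_measurable lebesgue"
  proof -
    have "(\<lambda>x. ennreal (g x - t) * indicator ?E x) = (\<lambda>x. ennreal (indicator Q x *\<^sub>R g x - t) * indicator ?E x)"
      using N(1) by (intro ext) (auto split: split_indicator)
    then show ?thesis using Es gm by simp
  qed
  ultimately have "AE x in lebesgue. ennreal (g x - t) * indicator ?E x = 0"
    by (simp add: nn_integral_0_iff_AE)
  then have "AE x in lebesgue. x \<notin> ?E" by eventually_elim (auto split: split_indicator_asm)
  then show ?thesis using Es by (simp add: AE_iff_null_sets)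
qed

text \<open>Let \<open>W\<close> be the union of the cubes with average above \<open>t\<close>. A
  dyadic cube that meets \<open>Q - W\<close> has average at most \<open>t\<close>, so
  \<open>g\<close> exceeds \<open>t\<close> there only on a null set. As a countable union of
  maximal cubes, \<open>W\<close> is measured by finite disjoint subfamilies, so bounds for finite
  families suffice.\<close>

lemma measure_superlevel_le:
  fixes g :: "real ^ 'n \<Rightarrow> real"
  assumes Q: "is_cube Q" and g: "integrable (lebesgue_on Q) g" "\<And>x. 0 \<le> g x" and t: "0 \<le> t"
    and B: "\<And>F. finite F \<Longrightarrow> disjoint F \<Longrightarrow> F \<subseteq> {R \<in> dyadic Q. t < avg R g} \<Longrightarrow>
      (\<Sum>R\<in>F. measure lebesgue R) \<le> B"
  shows "measure lebesgue {x \<in> Q. t < g x} \<le> B"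
proof -
  define T where "T = {R \<in> dyadic Q. t < avg R g}"
  define W where "W = \<Union>(maximal_cubes T)"
  have TQ: "T \<subseteq> dyadic Q" by (auto simp: T_def)
  have mT: "maximal_cubes T \<subseteq> T" by (auto simp: maximal_cubes_def)
  have cnt: "countable (maximal_cubes T)"
    using countable_dyadic mT TQ by (meson countable_subset)
  have lm: "R \<in> lmeasurable" if "R \<in> T" for R
    using that TQ dyadic_is_cube(1) is_cube_lmeasurable by blast
  have bound: "measure lebesgue (\<Union>R\<in>F. R) \<le> B" if F: "F \<subseteq> maximal_cubes T" "finite F" for F
  proof -
    have "measure lebesgue (\<Union>R\<in>F. R) \<le> (\<Sum>R\<in>F. measure lebesgue R)"
      using F mT lm by (intro measure_UNION_le) (auto dest: fmeasurableD)
    also have "\<dots> \<le> B"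
      using disjoint_maximal_cubes[OF TQ] F mT pairwise_subset
      by (intro B) (auto simp: T_def disjoint_def)
    finally show ?thesis .
  qed
  have lmm: "R \<in> lmeasurable" if "R \<in> maximal_cubes T" for R using that mT lm by auto
  have W: "W \<in> lmeasurable" "measure lebesgue W \<le> B"
    using fmeasurable_UN_bound[OF cnt lmm bound] measure_UN_bound[OF cnt lmm bound]
    by (simp_all add: W_def)
  have WT: "W = \<Union>T" unfolding W_def by (rule Union_maximal_cubes[OF TQ])
  have null: "{x \<in> Q - W. t < g x} \<in> null_sets lebesgue"
  proof (rule avg_le_imp_superlevel_null[OF Q g _ _ t])
    show "Q - W \<in> sets lebesgue" using W(1) Q is_cube_lmeasurable by blast
    show "avg R g \<le> t" if "R \<in> dyadic Q" "R \<inter> (Q - W) \<noteq> {}" for R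
      using that unfolding WT T_def by fastforce
  qed auto
  have "measure lebesgue {x \<in> Q. t < g x} \<le> measure lebesgue (W \<union> {x \<in> Q - W. t < g x})"
  proof (rule measure_mono_fmeasurable)
    have "{x \<in> Q. t < g x} = {x \<in> space (lebesgue_on Q). t < g x}" by (simp add: space_restrict_space)
    also have "\<dots> \<in> sets (lebesgue_on Q)" using g(1) by measurable
    finally show "{x \<in> Q. t < g x} \<in> sets lebesgue"
      using is_cube_lmeasurable[OF Q] by (simp add: sets_restrict_space_iff fmeasurableD)
    show "W \<union> {x \<in> Q - W. t < g x} \<in> lmeasurable"
      using W(1) null by (intro fmeasurable.Un) (auto simp: fmeasurable_def null_sets_def)
  qed auto
  also have "\<dots> = measure lebesgue W"
    using null W(1) by (intro measure_Un_null_set) auto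
  finally show ?thesis using W(2) by simp
qed

section \<open>The good-lambda inequality\<close>

text \<open>Here \<open>h R\<close> stands for the norm of \<open>B R f\<close>, and only the
  pointwise bound ties it to \<open>g\<close>. The family \<open>G\<close> consists of the maximal
  cubes at level \<open>t\<close> chosen to contain the members of \<open>F\<close>; the oscillation
  on each of them pays for the members of \<open>F\<close> assigned to it.\<close>

lemma good_lambda_step:
  fixes Q :: "(real ^ 'n) set" and g :: "real ^ 'n \<Rightarrow> real"
  assumes Q: "is_cube Q" and g: "integrable (lebesgue_on Q) g" "\<And>x. 0 \<le> g x"
    and b: "0 \<le> b"
    and h: "\<And>R. R \<in> dyadic Q \<Longrightarrow> integrable (lebesgue_on R) (h R)" "\<And>R x. 0 \<le> h R x"
      "\<And>R. R \<in> dyadic Q \<Longrightarrow> avg R (h R) \<le> a R"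
      "\<And>R. R \<in> dyadic Q \<Longrightarrow> AE x in lebesgue_on R. g x \<le> b * avg R g + h R x"
    and t: "0 < t" "avg Q g \<le> t"
    and F: "finite F" "disjoint F" "F \<subseteq> {R \<in> dyadic Q. (b * 2 ^ CARD('n) + 2) * t < avg R g}"
  obtains G where "finite G" "disjoint G" "G \<subseteq> {R \<in> dyadic Q. t < avg R g}"
    "t * (\<Sum>R\<in>F. measure lebesgue R) \<le> (\<Sum>R\<in>G. a R * measure lebesgue R)"
proof -
  let ?K = "b * 2 ^ CARD('n) + 2"
  define T where "T = {R \<in> dyadic Q. t < avg R g}"
  have TQ: "T \<subseteq> dyadic Q" by (auto simp: T_def)
  have "t \<le> ?K * t" using t(1) b by simp
  then have FT: "F \<subseteq> T" using F(3) by (auto simp: T_def)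
  have Qs: "Q \<in> sets lebesgue" using Q by (simp add: fmeasurableD is_cube_lmeasurable)
  have "\<forall>R\<in>F. \<exists>M. M \<in> maximal_cubes T \<and> R \<subseteq> M"
  proof
    fix R assume "R \<in> F"
    then have "R \<in> T" using FT by auto
    then obtain M where "M \<in> maximal_cubes T" "R \<subseteq> M" by (rule maximal_cubes_cover[OF TQ])
    then show "\<exists>M. M \<in> maximal_cubes T \<and> R \<subseteq> M" by auto
  qed
  then obtain M where M: "\<And>R. R \<in> F \<Longrightarrow> M R \<in> maximal_cubes T" "\<And>R. R \<in> F \<Longrightarrow> R \<subseteq> M R"
    by metis
  have avgM: "avg S g \<le> 2 ^ CARD('n) * t" if S: "S \<in> maximal_cubes T" for S
  proof -
    have SQ: "S \<in> dyadic Q" "S \<in> T" using S TQ by (auto simp: maximal_cubes_def)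
    \<comment> \<open>The average over \<open>Q\<close> is at most \<open>t\<close>, so a maximal
      cube is proper and has a parent. By maximality the parent has average at most
      \<open>t\<close>, and passing down to \<open>S\<close> costs only the ratio of the
      measures.\<close>
    then have "S \<noteq> Q" using t(2) by (auto simp: T_def)
    then obtain P where P: "P \<in> dyadic Q" "S \<subset> P"
        "measure lebesgue P = 2 ^ CARD('n) * measure lebesgue S"
      by (rule dyadic_parent[OF SQ(1)])
    have "P \<notin> T" using S P(2) by (auto simp: maximal_cubes_def)
    then have "avg P g \<le> t" using P(1) by (auto simp: T_def)
    have "avg S g * measure lebesgue S = (\<integral>x. g x \<partial>lebesgue_on S)"
      using dyadic_is_cube(1)[OF SQ(1)] by (simp add: integral_lebesgue_on_eq_avg)
    also have "\<dots> \<le> (\<integral>x. g x \<partial>lebesgue_on P)"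
      using SQ(1) P(1,2) g(2) integrable_lebesgue_on_subset[OF g(1) Qs dyadic_sets dyadic_subset]
      by (intro integral_subset_le dyadic_sets) auto
    also have "\<dots> = avg P g * measure lebesgue P"
      using dyadic_is_cube(1)[OF P(1)] by (simp add: integral_lebesgue_on_eq_avg)
    also have "\<dots> \<le> t * measure lebesgue P" using \<open>avg P g \<le> t\<close> by (intro mult_right_mono) auto
    finally have "avg S g * measure lebesgue S \<le> (2 ^ CARD('n) * t) * measure lebesgue S"
      by (simp add: P(3) mult_ac)
    then show ?thesis using dyadic_measure_pos[OF SQ(1)] by simp
  qed
  have local: "t * measure lebesgue R \<le> (\<integral>x. h S x \<partial>lebesgue_on R)"
    if R: "R \<in> F" and S: "M R = S" for R S
  proof -
    have SQ: "S \<in> dyadic Q" "S \<in> maximal_cubes T" using M(1)[OF R] S TQ by (auto simp: maximal_cubes_def)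
    have RQ: "R \<in> dyadic Q" using R FT TQ by blast
    have RS: "R \<subseteq> S" using M(2)[OF R] S by simp
    note Rc = dyadic_is_cube(1)[OF RQ] and Rs = dyadic_sets[OF RQ] and Ss = dyadic_sets[OF SQ(1)]
    have Rfin: "R \<in> lmeasurable" by (rule is_cube_lmeasurable[OF Rc])
    have hR: "integrable (lebesgue_on R) (h S)"
      using integrable_lebesgue_on_subset[OF h(1)[OF SQ(1)] Ss Rs RS] .
    have gR: "integrable (lebesgue_on R) g"
      using integrable_lebesgue_on_subset[OF g(1) Qs Rs dyadic_subset[OF RQ]] .
    note cR = const_lebesgue_on[OF Rfin]
    have "AE x in lebesgue_on R. g x \<le> b * avg S g + h S x"
      using h(4)[OF SQ(1)] RS Rs Ss by (auto simp: AE_restrict_space_iff elim: eventually_mono)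
    then have "(\<integral>x. g x \<partial>lebesgue_on R) \<le> (\<integral>x. b * avg S g + h S x \<partial>lebesgue_on R)"
      using gR hR cR by (intro integral_mono_AE) auto
    also have "\<dots> = b * avg S g * measure lebesgue R + (\<integral>x. h S x \<partial>lebesgue_on R)"
      using hR cR by simp
    also have "b * avg S g * measure lebesgue R \<le> b * (2 ^ CARD('n) * t) * measure lebesgue R"
      using avgM[OF SQ(2)] b by (intro mult_right_mono mult_left_mono) auto
    finally have "(\<integral>x. g x \<partial>lebesgue_on R)
        \<le> b * (2 ^ CARD('n) * t) * measure lebesgue R + (\<integral>x. h S x \<partial>lebesgue_on R)" by simp
    \<comment> \<open>The part \<open>b * 2 ^ CARD('n)\<close> of the level absorbs the average
      term; the summand 2 leaves at least \<open>t * measure lebesgue R\<close> for the integral of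
      \<open>h S\<close>.\<close>
    moreover have "?K * t * measure lebesgue R \<le> (\<integral>x. g x \<partial>lebesgue_on R)"
      using R F(3) Rc by (auto simp: integral_lebesgue_on_eq_avg intro!: mult_right_mono)
    moreover have "0 \<le> t * measure lebesgue R" using t(1) by simp
    ultimately show ?thesis by (simp add: algebra_simps)
  qed
  define G where "G = M ` F"
  have GT: "G \<subseteq> maximal_cubes T" using M(1) by (auto simp: G_def)
  \<comment> \<open>Grouping \<open>F\<close> by the assigned maximal cube makes each inner sum an
    estimate inside a single \<open>S\<close>.\<close>
  have "t * (\<Sum>R\<in>F. measure lebesgue R) = (\<Sum>S\<in>G. \<Sum>R\<in>{R \<in> F. M R = S}. t * measure lebesgue R)"
    unfolding G_def sum_distrib_left by (rule sum.image_gen[OF F(1)])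
  also have "\<dots> \<le> (\<Sum>S\<in>G. a S * measure lebesgue S)"
  proof (rule sum_mono)
    fix S assume "S \<in> G"
    then have S: "S \<in> dyadic Q" using GT TQ by (auto simp: maximal_cubes_def)
    have "(\<Sum>R\<in>{R \<in> F. M R = S}. t * measure lebesgue R)
        \<le> (\<Sum>R\<in>{R \<in> F. M R = S}. \<integral>x. h S x \<partial>lebesgue_on R)"
      using local by (intro sum_mono) auto
    also have "\<dots> \<le> (\<integral>x. h S x \<partial>lebesgue_on S)"
    proof (rule sum_integral_disjoint_le)
      show "disjoint {R \<in> F. M R = S}" using F(2) by (auto simp: disjoint_def)
      show "\<Union>{R \<in> F. M R = S} \<subseteq> S" using M(2) by blast
    qed (use F(1) FT TQ h(1)[OF S] h(2) dyadic_sets[OF S] in \<open>auto intro: dyadic_sets\<close>)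
    also have "\<dots> = avg S (h S) * measure lebesgue S"
      using dyadic_is_cube(1)[OF S] by (simp add: integral_lebesgue_on_eq_avg)
    also have "\<dots> \<le> a S * measure lebesgue S" using h(3)[OF S] by (intro mult_right_mono) auto
    finally show "(\<Sum>R\<in>{R \<in> F. M R = S}. t * measure lebesgue R) \<le> a S * measure lebesgue S" .
  qed
  finally have "t * (\<Sum>R\<in>F. measure lebesgue R) \<le> (\<Sum>S\<in>G. a S * measure lebesgue S)" .
  moreover have "disjoint G"
    using disjoint_maximal_cubes[OF TQ] GT by (auto simp: disjoint_def)
  moreover have "finite G" using F(1) by (simp add: G_def)
  moreover have "G \<subseteq> {R \<in> dyadic Q. t < avg R g}" using GT by (auto simp: maximal_cubes_def T_def)
  ultimately show ?thesis using that by blast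
qed

text \<open>For \<open>x > L\<close> the negative exponent \<open>1 - p\<close> makes the power of
  \<open>x\<close> smaller than that of \<open>L\<close>. This trades a linear sum of
  \<open>a\<close> for a small multiple of the measure plus a sum of p-th powers, which the D_p
  condition controls.\<close>

lemma le_add_powr:
  fixes x L p :: real
  assumes "0 \<le> x" "0 < L" "1 < p"
  shows "x \<le> L + x powr p * L powr (1 - p)"
proof (cases "x \<le> L")
  case False
  have "x = x powr p * x powr (1 - p)" using False assms by (simp flip: powr_add)
  also have "\<dots> \<le> x powr p * L powr (1 - p)"
    using False assms by (intro mult_left_mono powr_mono2') auto
  finally show ?thesis using assms by simp
qed (simp add: add_increasing2)

text \<open>\<open>X\<close> bounds both the average of \<open>g\<close> and the D_p sums on
  \<open>Q\<close>. The constants are tuned so that the recursion returns half of the previous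
  quantity plus half of the claimed bound; the claim therefore reproduces itself from one level to
  the next.\<close>

lemma good_lambda_iterate:
  fixes Q :: "(real ^ 'n) set" and g :: "real ^ 'n \<Rightarrow> real" and b p X :: real
  defines "K \<equiv> b * 2 ^ CARD('n) + 2"
  assumes Q: "is_cube Q" and g: "integrable (lebesgue_on Q) g" "\<And>x. 0 \<le> g x"
    and b: "0 \<le> b" and p: "1 < p"
    and h: "\<And>R. R \<in> dyadic Q \<Longrightarrow> integrable (lebesgue_on R) (h R)" "\<And>R x. 0 \<le> h R x"
      "\<And>R. R \<in> dyadic Q \<Longrightarrow> avg R (h R) \<le> a R"
      "\<And>R. R \<in> dyadic Q \<Longrightarrow> AE x in lebesgue_on R. g x \<le> b * avg R g + h R x"
    and a: "\<And>R. R \<in> dyadic Q \<Longrightarrow> 0 \<le> a R"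
    and X: "0 < X" "avg Q g \<le> X"
      "\<And>G. finite G \<Longrightarrow> disjoint G \<Longrightarrow> G \<subseteq> dyadic Q \<Longrightarrow>
        (\<Sum>R\<in>G. a R powr p * measure lebesgue R) \<le> X powr p * measure lebesgue Q"
    and t: "0 < t"
    and F: "finite F" "disjoint F" "F \<subseteq> {R \<in> dyadic Q. t < avg R g}"
  shows "t powr p * (\<Sum>R\<in>F. measure lebesgue R) \<le> (2 * K powr p * X) powr p * measure lebesgue Q"
proof -
  define H where "H = 2 * K powr p"
  have K: "2 \<le> K" unfolding K_def using b by simp
  have "K powr 1 \<le> K powr p" using K p by (intro powr_mono) auto
  then have KH: "K \<le> H" using K unfolding H_def by simp
  \<comment> \<open>Induction on how many factors \<open>K\<close> separate \<open>t\<close> from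
    \<open>X\<close>; since \<open>K\<close> is at least 2, every level is reached.\<close>
  have main: "t powr p * (\<Sum>R\<in>F. measure lebesgue R) \<le> (H * X) powr p * measure lebesgue Q"
    if "0 < t" "t \<le> K ^ n * X" "finite F" "disjoint F" "F \<subseteq> {R \<in> dyadic Q. t < avg R g}" for n t F
    using that
  proof (induction n arbitrary: t F)
    \<comment> \<open>At low levels the total measure is bounded by that of \<open>Q\<close>, so no
      prior finiteness of a weak norm is required.\<close>
    have base: "t powr p * (\<Sum>R\<in>F. measure lebesgue R) \<le> (H * X) powr p * measure lebesgue Q"
      if "0 < t" "t \<le> K * X" "finite F" "disjoint F" "F \<subseteq> dyadic Q" for t F
    proof (rule mult_mono)
      have "t \<le> H * X" using that(2) KH X(1) by (meson less_imp_le mult_right_mono order_trans)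
      then show "t powr p \<le> (H * X) powr p" using that(1) p by (intro powr_mono2) auto
      show "(\<Sum>R\<in>F. measure lebesgue R) \<le> measure lebesgue Q"
        using sum_measure_dyadic_le that(3-5) Q by blast
    qed (auto intro: sum_nonneg)
    {
      case 0
      have "t \<le> 1 * X" using 0 by simp
      also have "\<dots> \<le> K * X" using K X(1) by (intro mult_right_mono) auto
      finally have "t \<le> K * X" .
      then show ?case using 0 by (intro base) auto
    next
      case (Suc n)
      show ?case
      proof (cases "t \<le> K * X")
        case True
        then show ?thesis using Suc.prems by (intro base) auto
      next
        case False
        define s where "s = t / K"
        have tK: "t = K * s" using K by (simp add: s_def)
        have "K * X < K * s" using False tK by simp
        \<comment> \<open>The lower level \<open>s\<close> still exceeds \<open>X\<close>, hence the
          average over \<open>Q\<close>, as the good-lambda step demands.\<close>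
        then have s: "0 < s" "X < s" using K X(1) by auto
        have "K * s \<le> K * (K ^ n * X)" using Suc.prems(2) tK by (simp add: mult_ac)
        then have sn: "s \<le> K ^ n * X" using K by simp
        obtain G where G: "finite G" "disjoint G" "G \<subseteq> {R \<in> dyadic Q. s < avg R g}"
            "s * (\<Sum>R\<in>F. measure lebesgue R) \<le> (\<Sum>R\<in>G. a R * measure lebesgue R)"
          using good_lambda_step[OF Q g b h s(1) _ Suc.prems(3,4)] X(2) s(2) Suc.prems(5)
          unfolding tK K_def by force
        \<comment> \<open>This choice gives
          \<open>K powr p * s powr (p - 1) * L = s powr p / 2\<close>, because
          \<open>H = 2 * K powr p\<close>.\<close>
        define L where "L = s / H"
        have H: "0 < H" using K KH by simp
        have L: "0 < L" using s(1) H by (simp add: L_def)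
        have "(\<Sum>R\<in>G. a R * measure lebesgue R)
            \<le> (\<Sum>R\<in>G. (L + a R powr p * L powr (1 - p)) * measure lebesgue R)"
          using G(3) a p L by (intro sum_mono mult_right_mono le_add_powr) auto
        also have "\<dots> = L * (\<Sum>R\<in>G. measure lebesgue R)
            + L powr (1 - p) * (\<Sum>R\<in>G. a R powr p * measure lebesgue R)"
          by (simp add: algebra_simps sum.distrib sum_distrib_left)
        also have "\<dots> \<le> L * (\<Sum>R\<in>G. measure lebesgue R)
            + L powr (1 - p) * (X powr p * measure lebesgue Q)"
          using X(3)[OF G(1,2)] G(3) by (intro add_left_mono mult_left_mono) auto
        finally have "s * (\<Sum>R\<in>F. measure lebesgue R) \<le> \<dots>" using G(4) by simp
        \<comment> \<open>Since \<open>t = K * s\<close>, this factor turns the left-hand side into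
          the quantity to be bounded.\<close>
        then have "K powr p * s powr (p - 1) * (s * (\<Sum>R\<in>F. measure lebesgue R))
            \<le> K powr p * s powr (p - 1) * (L * (\<Sum>R\<in>G. measure lebesgue R)
              + L powr (1 - p) * (X powr p * measure lebesgue Q))"
          by (intro mult_left_mono) auto
        moreover have "K powr p * s powr (p - 1) * (s * (\<Sum>R\<in>F. measure lebesgue R))
            = t powr p * (\<Sum>R\<in>F. measure lebesgue R)"
        proof -
          have "s powr (p - 1) * s = s powr p" using s(1) by (simp add: powr_diff)
          then show ?thesis using K s(1) by (simp add: tK powr_mult mult.assoc[symmetric])
        qed
        moreover have "K powr p * s powr (p - 1) * (L * (\<Sum>R\<in>G. measure lebesgue R))
            = (s powr p * (\<Sum>R\<in>G. measure lebesgue R)) / 2"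
          using s(1) K by (simp add: L_def H_def powr_diff)
        moreover have "K powr p * s powr (p - 1) * (L powr (1 - p) * (X powr p * measure lebesgue Q))
            = (H * X) powr p * measure lebesgue Q / 2"
        proof -
          \<comment> \<open>The powers of \<open>s\<close> cancel; what remains,
            \<open>K powr p * H powr (p - 1)\<close>, is \<open>H powr p / 2\<close>, again by the
            choice of \<open>H\<close>.\<close>
          have "s powr (p - 1) * L powr (1 - p) = H powr (p - 1)"
            using s(1) H by (simp add: L_def powr_divide powr_diff field_simps)
          moreover have "K powr p * H powr (p - 1) = H powr p / 2"
            using H K by (simp add: powr_diff) (simp add: H_def)
          ultimately have "K powr p * s powr (p - 1) * L powr (1 - p) = H powr p / 2"
            by (simp add: mult.assoc)
          then have "K powr p * s powr (p - 1) * (L powr (1 - p) * (X powr p * measure lebesgue Q))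
              = H powr p / 2 * (X powr p * measure lebesgue Q)" by (metis mult.assoc)
          then show ?thesis using H X(1) by (simp add: powr_mult)
        qed
        moreover have "s powr p * (\<Sum>R\<in>G. measure lebesgue R) \<le> (H * X) powr p * measure lebesgue Q"
          using Suc.IH[OF s(1) sn G(1-3)] .
        ultimately show ?thesis by (simp add: distrib_left)
      qed
    }
  qed
  obtain n where "t / X < K ^ n" using real_arch_pow[of K "t / X"] K by auto
  then have "t \<le> K ^ n * X" using X(1) by (simp add: field_simps)
  from main[OF t this F] show ?thesis by (simp add: H_def)
qed

section \<open>Local oscillations\<close>

context
  fixes Q0 :: "(real ^ 'n) set" and CB :: real
    and B :: "(real ^ 'n) set \<Rightarrow>
      (real ^ 'n \<Rightarrow> 'b::{real_normed_field, banach, second_countable_topology}) \<Rightarrow> real ^ 'n \<Rightarrow> 'b"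
    and f :: "real ^ 'n \<Rightarrow> 'b"
  assumes LO: "local_oscillation Q0 CB B" and f: "integrable (lebesgue_on Q0) f"
begin

lemma integrable_on_dyadic:
  fixes g :: "real ^ 'n \<Rightarrow> 'b"
  assumes "Q \<in> dyadic Q0" "integrable (lebesgue_on Q0) g"
  shows "integrable (lebesgue_on Q) g"
proof (rule integrable_lebesgue_on_subset[OF assms(2)])
  show "Q0 \<in> sets lebesgue" using dyadic_is_cube(2)[OF assms(1)] is_cube_lmeasurable by blast
qed (rule dyadic_sets[OF assms(1)], rule dyadic_subset[OF assms(1)])

lemmas compl_op_linear = LO[unfolded local_oscillation_def, THEN conjunct1, rule_format, unfolded linear_op_L1_def]
lemmas compl_op_bound = LO[unfolded local_oscillation_def, THEN conjunct2, THEN conjunct1, rule_format]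
lemmas oscillation_compl_op = LO[unfolded local_oscillation_def, THEN conjunct2, THEN conjunct2, rule_format]

text \<open>Clause (b) bounds the function on \<open>Q\<close>, which has finite measure. On the
  whole of \<open>Q0\<close> only its measurability is known, hence the restriction to
  \<open>Q\<close>.\<close>

lemma compl_op_integrable:
  assumes Q: "Q \<in> dyadic Q0"
  shows "integrable (lebesgue_on Q) (compl_op B Q f)"
proof -
  have "compl_op B Q f \<in> borel_measurable (lebesgue_on Q0)"
    using compl_op_linear[OF Q] f by blast
  then have "compl_op B Q f \<in> borel_measurable (lebesgue_on Q)"
    by (rule measurable_restrict_mono[OF _ dyadic_subset[OF Q]])
  moreover have "AE x in lebesgue_on Q. norm (compl_op B Q f x) \<le> CB * avg Q (\<lambda>y. norm (f y))"
    by (rule compl_op_bound[OF Q f])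
  ultimately show ?thesis
    using finite_measure_lebesgue_on[OF is_cube_lmeasurable[OF dyadic_is_cube(1)[OF Q]]]
    by (intro finite_measure.integrable_const_bound)
qed

lemma oscillation_integrable:
  assumes Q: "Q \<in> dyadic Q0"
  shows "integrable (lebesgue_on Q) (B Q f)"
proof -
  have "B Q f = (\<lambda>x. f x - compl_op B Q f x)" by (simp add: compl_op_def)
  then show ?thesis using integrable_on_dyadic[OF Q f] compl_op_integrable[OF Q] by simp
qed

lemma integrable_indicator_dyadic:
  fixes u :: "real ^ 'n \<Rightarrow> 'b"
  assumes Q: "Q \<in> dyadic Q0" and u: "integrable (lebesgue_on Q) u"
  shows "integrable (lebesgue_on Q0) (\<lambda>x. indicator Q x *\<^sub>R u x)"
proof -
  have "(\<lambda>x. indicator Q0 x *\<^sub>R indicator Q x *\<^sub>R u x) = (\<lambda>x. indicator Q x *\<^sub>R u x)"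
    using dyadic_subset[OF Q] by (intro ext) (auto split: split_indicator)
  moreover have "Q0 \<in> sets lebesgue"
    using dyadic_is_cube(2)[OF Q] is_cube_lmeasurable by blast
  ultimately show ?thesis
    using u dyadic_sets[OF Q] by (simp add: set_integrable_lebesgue_on set_integrable_def)
qed

text \<open>Write A for \<open>compl_op B\<close>. On \<open>R\<close>, A_R f equals A_R applied to
  f cut off to \<open>Q\<close>. That function is the cut-off of B_Q f plus the cut-off of A_Q f,
  and clause (c) says that A_R fixes the latter. Hence B_Q f = A_R(B_Q f cut off) + B_R f on
  \<open>R\<close>, and clause (b) bounds the first term.\<close>

lemma oscillation_pointwise:
  assumes Q: "Q \<in> dyadic Q0" and R: "R \<in> dyadic Q"
  shows "AE x in lebesgue_on R.
    norm (B Q f x) \<le> CB * avg R (\<lambda>x. norm (B Q f x)) + norm (B R f x)"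
proof -
  have RQ0: "R \<in> dyadic Q0" using R Q by (rule dyadic_trans)
  have RQ: "R \<subseteq> Q" and QQ0: "Q \<subseteq> Q0" using R Q dyadic_subset by blast+
  have Rs: "R \<in> sets lebesgue" and Q0s: "Q0 \<in> sets lebesgue"
    using dyadic_sets[OF R] dyadic_is_cube(2)[OF Q] is_cube_lmeasurable by blast+
  let ?T = "compl_op B R"
  define q where "q = (\<lambda>y. indicator Q y *\<^sub>R f y)"
  define r where "r = (\<lambda>y. indicator Q y *\<^sub>R compl_op B Q f y)"
  define h where "h = (\<lambda>y. indicator Q y *\<^sub>R B Q f y)"
  define d where "d = (\<lambda>y. f y - q y)"
  have qi: "integrable (lebesgue_on Q0) q"
    unfolding q_def by (rule integrable_indicator_dyadic[OF Q integrable_on_dyadic[OF Q f]])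
  have ri: "integrable (lebesgue_on Q0) r"
    unfolding r_def by (rule integrable_indicator_dyadic[OF Q compl_op_integrable[OF Q]])
  have hi: "integrable (lebesgue_on Q0) h"
    unfolding h_def by (rule integrable_indicator_dyadic[OF Q oscillation_integrable[OF Q]])
  have di: "integrable (lebesgue_on Q0) d" unfolding d_def using f qi by simp
  have add: "AE x in lebesgue_on R. ?T (\<lambda>y. u y + v y) x = ?T u x + ?T v x"
    if "integrable (lebesgue_on Q0) u" "integrable (lebesgue_on Q0) v" for u v
  proof -
    have "AE x in lebesgue_on Q0. ?T (\<lambda>y. u y + v y) x = ?T u x + ?T v x"
      using compl_op_linear[OF RQ0] that by blast
    then show ?thesis using Rs Q0s RQ QQ0
      by (auto simp: AE_restrict_space_iff elim!: eventually_mono)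
  qed
  have bound: "AE x in lebesgue_on R. norm (?T u x) \<le> CB * avg R (\<lambda>y. norm (u y))"
    if "integrable (lebesgue_on Q0) u" for u
    by (rule compl_op_bound[OF RQ0 that])
  have avg_cong: "avg R u = avg R v" if "\<And>x. x \<in> R \<Longrightarrow> u x = v x" for u v :: "real ^ 'n \<Rightarrow> real"
    unfolding avg_def using that
    by (intro arg_cong2[where f = "(/)"] Bochner_Integration.integral_cong) (auto simp: space_restrict_space)
  \<comment> \<open>Locality of A_R: \<open>d\<close> vanishes on \<open>R\<close>, so clause (b)
    bounds its image there by zero.\<close>
  have "avg R (\<lambda>y. norm (d y)) = avg R (\<lambda>y. 0)"
    using RQ by (intro avg_cong) (auto simp: d_def q_def)
  also have "\<dots> = 0" by (simp add: avg_def)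
  finally have d0: "AE x in lebesgue_on R. ?T d x = 0"
    using bound[OF di] by simp
  have r0: "AE x in lebesgue_on R. B R r x = 0"
    unfolding r_def by (rule oscillation_compl_op[OF RQ0 Q RQ f])
  have hb: "AE x in lebesgue_on R. norm (?T h x) \<le> CB * avg R (\<lambda>x. norm (B Q f x))"
    using bound[OF hi] avg_cong[of "\<lambda>y. norm (h y)" "\<lambda>y. norm (B Q f y)"] RQ
    by (auto simp: h_def indicator_def subset_iff)
  have "(\<lambda>y. h y + r y) = q"
    by (auto simp: h_def r_def q_def compl_op_def simp flip: scaleR_add_right)
  then have hr: "AE x in lebesgue_on R. ?T q x = ?T h x + ?T r x" using add[OF hi ri] by simp
  have "(\<lambda>y. q y + d y) = f" by (simp add: d_def)
  then have qd: "AE x in lebesgue_on R. ?T f x = ?T q x + ?T d x" using add[OF qi di] by simp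
  have space: "AE x in lebesgue_on R. x \<in> R"
    using AE_space[of "lebesgue_on R"] by (simp add: space_restrict_space)
  have complR: "B S f x = f x - compl_op B S f x" for S x by (simp add: compl_op_def)
  show ?thesis
    using d0 r0 hb hr qd space
  proof eventually_elim
    case (elim x)
    \<comment> \<open>\<open>B R r\<close> vanishes at \<open>x\<close>, so A_R leaves
      \<open>r\<close> unchanged there, and \<open>r\<close> agrees with A_Q f on
      \<open>Q\<close>.\<close>
    have "?T r x = compl_op B Q f x" using elim RQ by (auto simp: compl_op_def r_def)
    then have "?T f x = ?T h x + compl_op B Q f x" using elim(1,4,5) by simp
    then have "B Q f x = ?T h x + B R f x"
      using complR[of Q x] complR[of R x] by simp
    then show ?case using elim norm_triangle_ineq[of "?T h x" "B R f x"] by simp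
  qed
qed

end

section \<open>From the recursion to the weak norm\<close>

lemma Dp_finite_family:
  assumes S: "finite S" "disjoint S" "S \<subseteq> dyadic Q"
    and c: "0 \<le> c" "\<And>S. S \<subseteq> dyadic Q \<Longrightarrow> disjoint S \<Longrightarrow>
        (\<Sum>\<^sub>\<infinity>R\<in>S. ennreal (a R powr p * measure lebesgue R))
          \<le> ennreal (c powr p * a Q powr p * measure lebesgue Q)"
    and a: "0 \<le> a Q"
  shows "(\<Sum>R\<in>S. a R powr p * measure lebesgue R) \<le> (c * a Q) powr p * measure lebesgue Q"
proof -
  have "ennreal (\<Sum>R\<in>S. a R powr p * measure lebesgue R)
      = (\<Sum>\<^sub>\<infinity>R\<in>S. ennreal (a R powr p * measure lebesgue R))"
    using S(1) by (simp add: sum_ennreal)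
  also have "\<dots> \<le> ennreal (c powr p * a Q powr p * measure lebesgue Q)"
    by (rule c(2)[OF S(3,2)])
  finally show ?thesis using c(1) a by (simp add: ennreal_le_iff powr_mult)
qed

text \<open>The iteration is applied with \<open>X = c * a Q\<close>. It needs a nonnegative
  coefficient, while the sign of \<open>CB\<close> is not prescribed; this explains
  \<open>max CB 0\<close>.\<close>

lemma oscillation_superlevel_le:
  fixes Q0 :: "(real ^ 'n) set" and CB p c t :: real and a :: "(real ^ 'n) set \<Rightarrow> real"
    and B :: "(real ^ 'n) set \<Rightarrow>
      (real ^ 'n \<Rightarrow> 'b::{real_normed_field, banach, second_countable_topology}) \<Rightarrow> real ^ 'n \<Rightarrow> 'b"
  assumes LO: "local_oscillation Q0 CB B" and f: "integrable (lebesgue_on Q0) f"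
    and a: "\<And>R. R \<in> dyadic Q0 \<Longrightarrow> 0 \<le> a R"
      "\<And>R. R \<in> dyadic Q0 \<Longrightarrow> avg R (\<lambda>x. norm (B R f x)) \<le> a R"
    and Q: "Q \<in> dyadic Q0" and p: "1 < p"
    and c: "0 \<le> c" "\<And>S. S \<subseteq> dyadic Q \<Longrightarrow> disjoint S \<Longrightarrow>
        (\<Sum>\<^sub>\<infinity>R\<in>S. ennreal (a R powr p * measure lebesgue R))
          \<le> ennreal (c powr p * a Q powr p * measure lebesgue Q)"
    and t: "0 < t"
  shows "measure lebesgue {x \<in> Q. t < norm (B Q f x)}
    \<le> (2 * (max CB 0 * 2 ^ CARD('n) + 2) powr p * (c * a Q) / t) powr p * measure lebesgue Q"
proof -
  let ?g = "\<lambda>x. norm (B Q f x)"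
  let ?K = "max CB 0 * 2 ^ CARD('n) + 2"
  have Qc: "is_cube Q" by (rule dyadic_is_cube(1)[OF Q])
  have Qs: "Q \<in> sets lebesgue" by (rule dyadic_sets[OF Q])
  have g: "integrable (lebesgue_on Q) ?g" using oscillation_integrable[OF LO f Q] by simp
  have sub: "R \<in> dyadic Q0" if "R \<in> dyadic Q" for R using that Q by (rule dyadic_trans)
  have pw: "AE x in lebesgue_on R. ?g x \<le> max CB 0 * avg R ?g + norm (B R f x)"
    if R: "R \<in> dyadic Q" for R
  proof -
    have "0 \<le> avg R ?g" by (simp add: avg_def)
    then have "CB * avg R ?g \<le> max CB 0 * avg R ?g" by (intro mult_right_mono) auto
    then show ?thesis using oscillation_pointwise[OF LO f Q R] by (auto elim!: eventually_mono)
  qed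
  have fam: "(\<Sum>R\<in>G. a R powr p * measure lebesgue R) \<le> (c * a Q) powr p * measure lebesgue Q"
    if "finite G" "disjoint G" "G \<subseteq> dyadic Q" for G
    using Dp_finite_family[OF that c a(1)[OF Q]] .
  show ?thesis
  proof (rule measure_superlevel_le[OF Qc g _ less_imp_le[OF t]])
    fix F assume F: "finite F" "disjoint F" "F \<subseteq> {R \<in> dyadic Q. t < avg R ?g}"
    show "(\<Sum>R\<in>F. measure lebesgue R) \<le> (2 * ?K powr p * (c * a Q) / t) powr p * measure lebesgue Q"
    proof (cases "a Q = 0")
      case True
      have "(\<integral>x. ?g x \<partial>lebesgue_on Q) \<le> 0"
        using a(2)[OF Q] True is_cube_measure_pos[OF Qc]
        by (simp add: integral_lebesgue_on_eq_avg[OF Qc] mult_nonpos_nonneg)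
      have "R \<notin> F" for R
      proof
        assume "R \<in> F"
        then have R: "R \<in> dyadic Q" "t < avg R ?g" using F(3) by auto
        have "0 < t * measure lebesgue R" using t dyadic_measure_pos[OF R(1)] by simp
        also have "\<dots> \<le> (\<integral>x. ?g x \<partial>lebesgue_on R)"
          using R(2) by (simp add: integral_lebesgue_on_eq_avg[OF dyadic_is_cube(1)[OF R(1)]] mult_right_mono)
        also have "\<dots> \<le> (\<integral>x. ?g x \<partial>lebesgue_on Q)"
          by (intro integral_subset_le dyadic_sets[OF R(1)] dyadic_subset[OF R(1)] Qs g) auto
        finally show False using \<open>(\<integral>x. ?g x \<partial>lebesgue_on Q) \<le> 0\<close> by simp
      qed
      then have "F = {}" by blast
      then show ?thesis by simp
    next
      case False
      then have aQ: "0 < a Q" using a(1)[OF Q] by simp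
      \<comment> \<open>The one-member family \<open>{Q}\<close> in the D_p condition shows that
        \<open>c\<close> cannot shrink \<open>a Q\<close>; thus \<open>X\<close> dominates the
        average of \<open>g\<close> over \<open>Q\<close>.\<close>
      have "a Q powr p * measure lebesgue Q \<le> (c * a Q) powr p * measure lebesgue Q"
        using fam[of "{Q}"] dyadic_refl[OF Qc] by simp
      then have "a Q powr p \<le> (c * a Q) powr p" using is_cube_measure_pos[OF Qc] by simp
      then have X: "a Q \<le> c * a Q"
        using powr_less_mono2[of p "c * a Q" "a Q"] p c(1) aQ by (smt (verit) mult_nonneg_nonneg)
      have "t powr p * (\<Sum>R\<in>F. measure lebesgue R)
          \<le> (2 * ?K powr p * (c * a Q)) powr p * measure lebesgue Q"
      proof (rule good_lambda_iterate[where g = ?g and h = "\<lambda>R x. norm (B R f x)" and a = a])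
        show "integrable (lebesgue_on R) (\<lambda>x. norm (B R f x))" if "R \<in> dyadic Q" for R
          using oscillation_integrable[OF LO f sub[OF that]] by simp
        show "0 < c * a Q" using X aQ by simp
        show "avg Q ?g \<le> c * a Q" using a(2)[OF Q] X by simp
      qed (use Qc g p t F fam pw a sub in auto)
      moreover have "(2 * ?K powr p * (c * a Q) / t) powr p = (2 * ?K powr p * (c * a Q)) powr p / t powr p"
        by (rule powr_divide)
      moreover have "s \<le> y / u * m" if "u * s \<le> y * m" "0 < u" for s y u m :: real
        using that by (simp add: field_simps)
      ultimately show ?thesis using t by simp
    qed
  qed simp
qed

lemma weak_Lp_norm_leI:
  assumes "0 < p" "0 \<le> M" "0 < measure lebesgue Q"
    and "\<And>t. 0 < t \<Longrightarrow>
      measure lebesgue {x \<in> Q. t < norm (u x)} \<le> (M / t) powr p * measure lebesgue Q"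
  shows "weak_Lp_norm p Q u \<le> ennreal M"
  unfolding weak_Lp_norm_def
proof (intro SUP_least ennreal_leI)
  fix t :: real assume "t \<in> {0<..}"
  then have t: "0 < t" by simp
  have "measure lebesgue {x \<in> Q. t < norm (u x)} / measure lebesgue Q \<le> (M / t) powr p"
    using assms(3) assms(4)[OF t] by (simp add: pos_divide_le_eq)
  then have "(measure lebesgue {x \<in> Q. t < norm (u x)} / measure lebesgue Q) powr (1 / p)
      \<le> ((M / t) powr p) powr (1 / p)"
    using assms(1) by (intro powr_mono2) auto
  also have "\<dots> = M / t" using assms(1,2) t by (simp add: powr_powr)
  finally show "t * (measure lebesgue {x \<in> Q. t < norm (u x)} / measure lebesgue Q) powr (1 / p) \<le> M"
    using t by (simp add: field_simps)
qed

text \<open>Carries an estimate from all admissible constants to their infimum, attained or not.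
  Nonemptiness of \<open>Z\<close> matters for \<open>k = 0\<close>, where an empty infimum would
  give zero times infinity, that is 0, with \<open>w\<close> unrestricted.\<close>

lemma le_mult_INF_ennreal:
  fixes w :: ennreal and k :: real
  assumes "Z \<noteq> {}" "0 \<le> k" "\<And>c. c \<in> Z \<Longrightarrow> w \<le> ennreal k * ennreal c"
  shows "w \<le> ennreal k * (INF c\<in>Z. ennreal c)"
proof (cases "k = 0")
  case True
  then show ?thesis using assms by auto
next
  case False
  then have k: "ennreal (1 / k) * ennreal k = 1"
    using assms(2) by (simp flip: ennreal_mult)
  have "ennreal (1 / k) * w \<le> (INF c\<in>Z. ennreal c)"
  proof (rule INF_greatest)
    fix c assume "c \<in> Z"
    then have "ennreal (1 / k) * w \<le> ennreal (1 / k) * (ennreal k * ennreal c)"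
      using assms(3) by (intro mult_left_mono) auto
    then show "ennreal (1 / k) * w \<le> ennreal c" by (simp add: k flip: mult.assoc)
  qed
  then have "ennreal k * (ennreal (1 / k) * w) \<le> ennreal k * (INF c\<in>Z. ennreal c)"
    by (intro mult_left_mono) auto
  moreover have "ennreal k * (ennreal (1 / k) * w) = w"
    using k by (metis mult.assoc mult.commute mult_1)
  ultimately show ?thesis by simp
qed

theorem corollary4p8:
  fixes p CB :: real
  assumes "1 < p"
  shows "\<exists>C\<ge>0::real. \<forall>(Q0 :: (real ^ 'n) set)
      (B :: (real ^ 'n) set \<Rightarrow>
        (real ^ 'n \<Rightarrow> 'b::{real_normed_field, banach, second_countable_topology}) \<Rightarrow> real ^ 'n \<Rightarrow> 'b)
      (f :: real ^ 'n \<Rightarrow> 'b) (a :: (real ^ 'n) set \<Rightarrow> real).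
    is_cube Q0 \<longrightarrow>
    local_oscillation Q0 CB B \<longrightarrow>
    integrable (lebesgue_on Q0) f \<longrightarrow>
    (\<forall>Q\<in>dyadic Q0. 0 \<le> a Q) \<longrightarrow>
    (\<forall>Q\<in>dyadic Q0. avg Q (\<lambda>x. norm (B Q f x)) \<le> a Q) \<longrightarrow>
    Dp_norm p Q0 a < \<infinity> \<longrightarrow>
    (\<forall>Q\<in>dyadic Q0. weak_Lp_norm p Q (B Q f) \<le> ennreal C * Dp_norm p Q0 a * ennreal (a Q))"
\<comment> \<open>The constant is the factor of \<open>X\<close> in the iteration, with
  \<open>max CB 0\<close> for its coefficient \<open>b\<close>.\<close>
proof (intro exI[of _ "2 * (max CB 0 * 2 ^ CARD('n) + 2) powr p"] conjI allI impI ballI)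
  let ?C = "2 * (max CB 0 * 2 ^ CARD('n) + 2) powr p"
  fix Q0 Q :: "(real ^ 'n) set" and a :: "(real ^ 'n) set \<Rightarrow> real" and f :: "real ^ 'n \<Rightarrow> 'b"
    and B :: "(real ^ 'n) set \<Rightarrow> (real ^ 'n \<Rightarrow> 'b) \<Rightarrow> real ^ 'n \<Rightarrow> 'b"
  assume LO: "local_oscillation Q0 CB B" and f: "integrable (lebesgue_on Q0) f"
    and a: "\<forall>Q\<in>dyadic Q0. 0 \<le> a Q" "\<forall>Q\<in>dyadic Q0. avg Q (\<lambda>x. norm (B Q f x)) \<le> a Q"
    and D: "Dp_norm p Q0 a < \<infinity>" and Q: "Q \<in> dyadic Q0"
  define Z where "Z = {c::real. 0 \<le> c \<and> (\<forall>S\<subseteq>dyadic Q. disjoint S \<longrightarrow>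
        (\<Sum>\<^sub>\<infinity>R\<in>S. ennreal (a R powr p * measure lebesgue R))
          \<le> ennreal (c powr p * a Q powr p * measure lebesgue Q))}"
  have INF: "(INF c\<in>Z. ennreal c) \<le> Dp_norm p Q0 a"
    unfolding Dp_norm_def Z_def using Q by (intro SUP_upper2[of Q]) (simp_all add: Dp_norm_at_def)
  \<comment> \<open>The infimum of the empty set is infinite, so finiteness of the D_p norm supplies
    an admissible constant.\<close>
  have "Z \<noteq> {}" using INF D by auto
  have aQ: "0 \<le> a Q" using a(1) Q by blast
  have "weak_Lp_norm p Q (B Q f) \<le> ennreal (?C * a Q) * ennreal c" if "c \<in> Z" for c
  proof -
    have c: "(\<Sum>\<^sub>\<infinity>R\<in>S. ennreal (a R powr p * measure lebesgue R))
          \<le> ennreal (c powr p * a Q powr p * measure lebesgue Q)"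
      if "S \<subseteq> dyadic Q" "disjoint S" for S
      using \<open>c \<in> Z\<close> that by (auto simp: Z_def)
    have c0: "0 \<le> c" using \<open>c \<in> Z\<close> by (simp add: Z_def)
    have "weak_Lp_norm p Q (B Q f) \<le> ennreal (?C * (c * a Q))"
    proof (rule weak_Lp_norm_leI)
      show "0 < measure lebesgue Q" by (rule dyadic_measure_pos[OF Q])
      show "measure lebesgue {x \<in> Q. t < norm (B Q f x)} \<le> (?C * (c * a Q) / t) powr p * measure lebesgue Q"
        if "0 < t" for t
        using a by (intro oscillation_superlevel_le[OF LO f _ _ Q assms c0 c that]) auto
    qed (use assms aQ c0 in auto)
    also have "\<dots> = ennreal (?C * a Q) * ennreal c"
      using aQ c0 by (simp add: mult_ac flip: ennreal_mult)
    finally show ?thesis .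
  qed
  then have "weak_Lp_norm p Q (B Q f) \<le> ennreal (?C * a Q) * (INF c\<in>Z. ennreal c)"
    using \<open>Z \<noteq> {}\<close> aQ by (intro le_mult_INF_ennreal) auto
  also have "\<dots> \<le> ennreal (?C * a Q) * Dp_norm p Q0 a"
    by (intro mult_left_mono INF) auto
  also have "\<dots> = ennreal ?C * Dp_norm p Q0 a * ennreal (a Q)"
    using aQ by (simp add: ennreal_mult mult_ac)
  finally show "weak_Lp_norm p Q (B Q f) \<le> ennreal ?C * Dp_norm p Q0 a * ennreal (a Q)" .
qed simp

end
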